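(* Let $V$ be an infinite-dimensional vector space over a field $\mathbb{F}$, let $w$ be a finite-rank endomorphism of $V$, let $\lambda\in\mathbb{F}$, and let $p_1,p_2,p_3\in\mathbb{F}[t]$ be split polynomials of degree $2$. Let $A\in[w]$, of size $n(w)\times n(w)$. Then the following are equivalent: (i) the endomorphism $\lambda\,\mathrm{id}_V+w$ is a $(p_1,p_2,p_3)$-sum; (ii) either $\lambda$ is a $(p_1,p_2,p_3)$-sum or $2\lambda=\operatorname{tr}p_1+\operatorname{tr}p_2+\operatorname{tr}p_3$, and there exists an integer $q\ge 0$ such that the block-diagonal matrix $(A+\lambda I_{n(w)})\oplus\lambda I_q$ is a $(p_1,p_2,p_3)$-sum.
   Context: An endomorphism (resp. square matrix) $u$ is a $(p_1,p_2,p_3)$-sum if $u=u_1+u_2+u_3$ for endomorphisms (resp. matrices of the same size) $u_k$ with $p_k(u_k)=0$ for all $k$. A scalar $\lambda$ is a $(p_1,p_2,p_3)$-sum if $\lambda=x_1+x_2+x_3$ with $x_k\in\mathbb{F}$ and $p_k(x_k)=0$. The trace $\operatorname{tr}p$ of a nonconstant polynomial $p$ with leading coefficient $\alpha$ is the opposite of the coefficient of $\alpha^{-1}p$ on $t^{\deg p-1}$. For a finite-rank endomorphism $w$ of $V$: choose a minimal (finite-dimensional) linear subspace $W$ of $V$ such that $\operatorname{im}w\subset W$ and $W+\operatorname{Ker}w=V$; its dimension $n(w)$ does not depend on the choice, and $[w]$ denotes the similarity class of matrices representing the endomorphism $w_{|W}$ of $W$, which also does not depend on the choice of $W$. *)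

theory Defs
  imports "HOL-Computational_Algebra.Polynomial" "Jordan_Normal_Form.Matrix"
begin

definition split_deg2 :: "'a::field poly \<Rightarrow> bool" where
  "split_deg2 p \<longleftrightarrow> degree p = 2 \<and>
     (\<exists>a b. p = Polynomial.smult (lead_coeff p) ([:-a, 1:] * [:-b, 1:]))"

definition poly_trace :: "'a::field poly \<Rightarrow> 'a" where
  "poly_trace p = - (coeff p (degree p - 1) / lead_coeff p)"

definition scalar_psum :: "'a::field poly \<Rightarrow> 'a poly \<Rightarrow> 'a poly \<Rightarrow> 'a \<Rightarrow> bool" where
  "scalar_psum p1 p2 p3 x \<longleftrightarrow>
     (\<exists>x1 x2 x3. x = x1 + x2 + x3 \<and> poly p1 x1 = 0 \<and> poly p2 x2 = 0 \<and> poly p3 x3 = 0)"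

definition endo_poly :: "('a::field \<Rightarrow> 'v::ab_group_add \<Rightarrow> 'v) \<Rightarrow> 'a poly \<Rightarrow> ('v \<Rightarrow> 'v) \<Rightarrow> 'v \<Rightarrow> 'v" where
  "endo_poly scale p u v = (\<Sum>i\<le>degree p. scale (coeff p i) ((u ^^ i) v))"

definition endo_psum ::
  "('a::field \<Rightarrow> 'v::ab_group_add \<Rightarrow> 'v) \<Rightarrow> 'a poly \<Rightarrow> 'a poly \<Rightarrow> 'a poly \<Rightarrow> ('v \<Rightarrow> 'v) \<Rightarrow> bool" where
  "endo_psum scale p1 p2 p3 u \<longleftrightarrow>
     (\<exists>u1 u2 u3. Vector_Spaces.linear scale scale u1 \<and> Vector_Spaces.linear scale scale u2 \<and>
        Vector_Spaces.linear scale scale u3 \<and> (\<forall>v. u v = u1 v + u2 v + u3 v) \<and>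
        (\<forall>v. endo_poly scale p1 u1 v = 0) \<and> (\<forall>v. endo_poly scale p2 u2 v = 0) \<and>
        (\<forall>v. endo_poly scale p3 u3 v = 0))"

definition finite_rank :: "('a::field \<Rightarrow> 'v::ab_group_add \<Rightarrow> 'v) \<Rightarrow> ('v \<Rightarrow> 'v) \<Rightarrow> bool" where
  "finite_rank scale w \<longleftrightarrow> Vector_Spaces.linear scale scale w \<and>
     (\<exists>S. finite S \<and> range w \<subseteq> module.span scale S)"

definition infinite_dimensional :: "('a::field \<Rightarrow> 'v::ab_group_add \<Rightarrow> 'v) \<Rightarrow> bool" where
  "infinite_dimensional scale \<longleftrightarrow> \<not> (\<exists>S. finite S \<and> module.span scale S = UNIV)"

definition adapted_subspace :: "('a::field \<Rightarrow> 'v::ab_group_add \<Rightarrow> 'v) \<Rightarrow> ('v \<Rightarrow> 'v) \<Rightarrow> 'v set \<Rightarrow> bool" where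
  "adapted_subspace scale w W \<longleftrightarrow> module.subspace scale W \<and> range w \<subseteq> W \<and>
     (\<forall>v. \<exists>x\<in>W. \<exists>y. w y = 0 \<and> v = x + y)"

definition minimal_adapted_subspace :: "('a::field \<Rightarrow> 'v::ab_group_add \<Rightarrow> 'v) \<Rightarrow> ('v \<Rightarrow> 'v) \<Rightarrow> 'v set \<Rightarrow> bool" where
  "minimal_adapted_subspace scale w W \<longleftrightarrow> adapted_subspace scale w W \<and>
     (\<forall>W'. adapted_subspace scale w W' \<and> W' \<subseteq> W \<longrightarrow> W' = W)"

definition in_class :: "('a::field \<Rightarrow> 'v::ab_group_add \<Rightarrow> 'v) \<Rightarrow> ('v \<Rightarrow> 'v) \<Rightarrow> 'a mat \<Rightarrow> bool" where
  "in_class scale w A \<longleftrightarrow>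
     (\<exists>W bs. minimal_adapted_subspace scale w W \<and> distinct bs \<and>
        \<not> module.dependent scale (set bs) \<and> module.span scale (set bs) = W \<and>
        A \<in> carrier_mat (length bs) (length bs) \<and>
        (\<forall>j<length bs. w (bs ! j) = (\<Sum>i<length bs. scale (A $$ (i, j)) (bs ! i))))"

definition mat_poly :: "'a::field poly \<Rightarrow> 'a mat \<Rightarrow> 'a mat" where
  "mat_poly p A = foldr (\<lambda>i M. coeff p i \<cdot>\<^sub>m (A ^\<^sub>m i) + M) [0..<Suc (degree p)]
                     (0\<^sub>m (dim_row A) (dim_row A))"

definition mat_psum :: "'a::field poly \<Rightarrow> 'a poly \<Rightarrow> 'a poly \<Rightarrow> 'a mat \<Rightarrow> bool" where
  "mat_psum p1 p2 p3 A \<longleftrightarrow> (let n = dim_row A in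
     (\<exists>A1 A2 A3. A1 \<in> carrier_mat n n \<and> A2 \<in> carrier_mat n n \<and> A3 \<in> carrier_mat n n \<and>
        A = A1 + A2 + A3 \<and> mat_poly p1 A1 = 0\<^sub>m n n \<and> mat_poly p2 A2 = 0\<^sub>m n n \<and>
        mat_poly p3 A3 = 0\<^sub>m n n))"

end

theory Submission
  imports Defs
begin

text \<open>
  Write \<open>\<lambda> + w = a + b + c\<close> with \<open>a\<close>, \<open>b\<close>, \<open>c\<close> annihilated by quadratic polynomials of traces
  \<open>ta\<close>, \<open>tb\<close>, \<open>tc\<close>. The element \<open>z = tb a + ta b - a b - b a\<close> commutes with \<open>a\<close> and \<open>b\<close>, and up to
  a scalar it equals \<open>(a + b) (ta + tb - a - b)\<close>. Substituting \<open>a + b = \<lambda> + w - c\<close> gives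
  \<open>z = k + d c + r\<close> with \<open>r\<close> of finite rank and \<open>d = 2 \<lambda> - ta - tb - tc\<close>.

  If \<open>d \<noteq> 0\<close>, then \<open>a\<close>, \<open>b\<close>, \<open>c\<close> commute modulo finite rank. Multiplying the identity by suitable
  factors of the split polynomials produces an endomorphism of infinite rank on which all three act
  as scalars modulo finite rank, and \<open>\<lambda>\<close> is the sum of these scalars.

  In all cases some monic quadratic polynomial in \<open>z\<close> has finite rank. As its range is stable under
  \<open>a\<close> and \<open>b\<close>, adding it to the words \<open>1, a, b, a b\<close> times \<open>1, z\<close> applied to a finite-dimensional
  space containing the range of \<open>w\<close> yields a finite-dimensional stable subspace, and restricting
  to it gives the block matrix.

  Conversely, one extends the matrices to \<open>V\<close> along a basis whose new vectors lie in the kernel of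
  \<open>w\<close>. There \<open>a\<close>, \<open>b\<close>, \<open>c\<close> are taken scalar, or, if \<open>d = 0\<close>, the new vectors are grouped in pairs
  and \<open>\<lambda>\<close> is written on each plane as a sum of three matrices with prescribed characteristic
  polynomials.
\<close>

subsection \<open>Endomorphisms modulo finite rank\<close>

locale endomorphisms = vector_space scale
  for scale :: "'a::field \<Rightarrow> 'v::ab_group_add \<Rightarrow> 'v" (infixr \<open>*s\<close> 75)
begin

sublocale endo: vector_space_pair scale scale
  by unfold_locales

abbreviation lin :: "('v \<Rightarrow> 'v) \<Rightarrow> bool"
  where "lin \<equiv> Vector_Spaces.linear scale scale"

lemma lin_iff: "lin f \<longleftrightarrow> (\<forall>x y. f (x + y) = f x + f y) \<and> (\<forall>c x. f (c *s x) = c *s f x)"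
  by (simp add: Vector_Spaces.linear_iff vector_space_axioms)

lemma lin_simps:
  assumes "lin f"
  shows "f (x + y) = f x + f y" "f (x - y) = f x - f y" "f (- x) = - f x" "f 0 = 0"
    "f (c *s x) = c *s f x"
  using assms by (simp_all add: endo.linear_add endo.linear_diff endo.linear_neg endo.linear_0
      endo.linear_scale)

lemma span_image_subset:
  assumes "lin f" and "\<And>x. x \<in> S \<Longrightarrow> f x \<in> span T" and "x \<in> span S"
  shows "f x \<in> span T"
  using assms(3)
proof (induction rule: span_induct_alt)
  case base
  then show ?case by (simp add: lin_simps[OF assms(1)] span_zero)
next
  case (step c x y)
  then show ?case by (simp add: lin_simps[OF assms(1)] span_add span_scale assms(2))
qed

text \<open>In contrast to \<open>finite_rank\<close>, linearity is kept separate, so the closure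
  rules under sums and precomposition have no linearity side conditions.\<close>

definition fin_rank :: "('v \<Rightarrow> 'v) \<Rightarrow> bool"
  where "fin_rank f \<longleftrightarrow> (\<exists>S. finite S \<and> range f \<subseteq> span S)"

lemma fin_rank_add:
  assumes "fin_rank f" and "fin_rank g"
  shows "fin_rank (\<lambda>v. f v + g v)"
proof -
  obtain S T where "finite S" "range f \<subseteq> span S" "finite T" "range g \<subseteq> span T"
    using assms unfolding fin_rank_def by blast
  then have "finite (S \<union> T)" "range (\<lambda>v. f v + g v) \<subseteq> span (S \<union> T)"
    by (auto simp: span_Un, blast)
  then show ?thesis unfolding fin_rank_def by blast
qed

lemma fin_rank_comp: "fin_rank f \<Longrightarrow> fin_rank (\<lambda>v. f (g v))"
  unfolding fin_rank_def by blast

lemma fin_rank_lin_comp: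
  assumes "lin f" and "fin_rank g"
  shows "fin_rank (\<lambda>v. f (g v))"
proof -
  obtain S where S: "finite S" "range g \<subseteq> span S" using assms(2) unfolding fin_rank_def by blast
  have "range (\<lambda>v. f (g v)) \<subseteq> span (f ` S)"
    using span_image_subset[OF assms(1), of S "f ` S"] S(2) by (auto intro: span_base)
  then show ?thesis using S(1) unfolding fin_rank_def by blast
qed

lemma lin_scale_const: "lin (\<lambda>v. c *s v)"
  by (simp add: lin_iff algebra_simps)

lemma lin_ident: "lin (\<lambda>v. v)"
  by (simp add: lin_iff)

lemma fin_rank_scale: "fin_rank f \<Longrightarrow> fin_rank (\<lambda>v. c *s f v)"
  by (rule fin_rank_lin_comp[OF lin_scale_const])

lemma fin_rank_diff:
  assumes "fin_rank f" and "fin_rank g"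
  shows "fin_rank (\<lambda>v. f v - g v)"
  using fin_rank_add[OF assms(1) fin_rank_scale[OF assms(2), of "- 1"]] by simp

lemmas fin_rank_intros = fin_rank_add fin_rank_diff fin_rank_scale

lemma fin_rank_scale_cancel:
  assumes "fin_rank (\<lambda>v. c *s e v)" and "\<not> fin_rank e"
  shows "c = 0"
proof (rule ccontr)
  assume "c \<noteq> 0"
  then show False using fin_rank_scale[OF assms(1), of "inverse c"] assms(2) by simp
qed

text \<open>An independent subset of the range is no larger than the finite set whose span contains
  it. The exact equality matters later, where stability of the range itself is used.\<close>

lemma fin_rank_range:
  assumes "lin f" and "fin_rank f"
  obtains T where "finite T" and "span T = range f"
proof -
  obtain S where S: "finite S" "range f \<subseteq> span S" using assms(2) unfolding fin_rank_def by blast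
  obtain B where B: "B \<subseteq> range f" "independent B" "range f \<subseteq> span B"
    using maximal_independent_subset[of "range f"] by blast
  have "subspace (range f)" using endo.linear_subspace_image[OF assms(1) subspace_UNIV] .
  then have "span B = range f" using span_minimal[OF B(1)] B(3) by blast
  moreover have "finite B" using independent_span_bound[OF S(1) B(2)] B(1) S(2) by blast
  ultimately show thesis using that by blast
qed

text \<open>Since \<open>(f - y) (f - x) = 0\<close>, either \<open>(f - x) e\<close> has finite
  rank, and \<open>e\<close> itself serves with \<open>u = x\<close>, or \<open>(f - x) e\<close>
  serves with \<open>u = y\<close>. The last clause preserves scalar relations already obtained for
  other endomorphisms, so that the lemma can be iterated.\<close>

lemma eigenvalue_mod_fin_rank:
  assumes f: "lin f" and ff: "\<And>v. f (f v) = (x + y) *s f v - (x * y) *s v"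
    and e: "lin e" "\<not> fin_rank e"
  obtains u e' where "u \<in> {x, y}" "lin e'" "\<not> fin_rank e'" "fin_rank (\<lambda>v. f (e' v) - u *s e' v)"
    "\<forall>g m. lin g \<longrightarrow> fin_rank (\<lambda>v. g (f v) - f (g v)) \<longrightarrow> fin_rank (\<lambda>v. g (e v) - m *s e v) \<longrightarrow>
      fin_rank (\<lambda>v. g (e' v) - m *s e' v)"
proof (cases "fin_rank (\<lambda>v. f (e v) - x *s e v)")
  case True
  then show thesis using that[of x e] e by simp
next
  case False
  let ?e = "\<lambda>v. f (e v) - x *s e v"
  have 0: "f (?e v) - y *s ?e v = 0" for v
    by (simp add: lin_simps[OF f] ff algebra_simps)
  have "lin ?e" by (simp add: lin_iff lin_simps[OF f] lin_simps[OF e(1)] algebra_simps)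
  moreover have "fin_rank (\<lambda>v. f (?e v) - y *s ?e v)"
    unfolding 0 fin_rank_def by (auto intro!: exI[of _ "{}"])
  moreover have "fin_rank (\<lambda>v. g (?e v) - m *s ?e v)"
    if g: "lin g" "fin_rank (\<lambda>v. g (f v) - f (g v))" and ge: "fin_rank (\<lambda>v. g (e v) - m *s e v)" for g m
  proof -
    \<comment> \<open>This is \<open>(f - x) (g e - m e)\<close> plus the commutator of
      \<open>g\<close> and \<open>f\<close> applied to \<open>e\<close>.\<close>
    have 1: "g (?e v) - m *s ?e v
      = f (g (e v) - m *s e v) - x *s (g (e v) - m *s e v) + (g (f (e v)) - f (g (e v)))" for v
      by (simp add: lin_simps[OF f] lin_simps[OF g(1)] algebra_simps)
    show ?thesis
      unfolding 1 by (intro fin_rank_add[OF fin_rank_diff] fin_rank_lin_comp[OF f ge]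
        fin_rank_scale[OF ge] fin_rank_comp[OF g(2)])
  qed
  ultimately show thesis using that[of y ?e] False by blast
qed

end

subsection \<open>Triples of quadratic endomorphisms\<close>

text \<open>The scalars \<open>ta\<close>, \<open>tb\<close>, \<open>tc\<close> are the traces of
  the annihilating monic quadratics and \<open>na\<close>, \<open>nb\<close>, \<open>nc\<close>
  their constant coefficients.\<close>

locale quadratic_triple = endomorphisms scale
  for scale :: "'a::field \<Rightarrow> 'v::ab_group_add \<Rightarrow> 'v" (infixr \<open>*s\<close> 75) +
  fixes a b c w :: "'v \<Rightarrow> 'v" and ta na tb nb tc nc l :: 'a
  assumes lin_a: "lin a" and lin_b: "lin b" and lin_c: "lin c" and lin_w: "lin w"
    and aa: "a (a v) = ta *s a v - na *s v"
    and bb: "b (b v) = tb *s b v - nb *s v"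
    and cc: "c (c v) = tc *s c v - nc *s v"
    and sum_eq: "a v + b v + c v = l *s v + w v"
    and fin_rank_w: "fin_rank w"
begin

section \<open>The element \<open>z\<close> and a finite-dimensional stable subspace\<close>

lemmas ls = lin_simps[OF lin_a] lin_simps[OF lin_b] lin_simps[OF lin_c] lin_simps[OF lin_w]

text \<open>With conjugates \<open>a' = ta - a\<close> and \<open>b' = tb - b\<close>, this is
  \<open>a b' + b a'\<close>, the polarised norm. Both \<open>z a\<close> and \<open>a z\<close>
  reduce to \<open>ta tb a - na tb + na b - a b a\<close>.\<close>

definition z :: "'v \<Rightarrow> 'v"
  where "z v = tb *s a v + ta *s b v - a (b v) - b (a v)"

lemma z_a: "z (a v) = a (z v)"
  unfolding z_def by (simp add: ls aa algebra_simps)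

lemma z_b: "z (b v) = b (z v)"
  unfolding z_def by (simp add: ls bb algebra_simps)

lemma lin_z: "lin z"
  unfolding lin_iff z_def by (simp add: ls algebra_simps)

text \<open>Substituting \<open>a + b = l + w - c\<close> into
  \<open>(a + b) (ta + tb - a - b)\<close> gives \<open>r\<close> as the terms containing
  \<open>w\<close>, \<open>d\<close> as the coefficient of \<open>c\<close>, and
  \<open>k + na + nb\<close> as the constant. The trace condition on \<open>l\<close> is
  \<open>d = 0\<close>.\<close>

definition r :: "'v \<Rightarrow> 'v"
  where "r v = (ta + tb - (l + l)) *s w v + c (w v) + w (c v) - w (w v)"

definition d :: 'a where "d = l + l - ta - tb - tc"
definition k :: 'a where "k = l * (ta + tb - l) + nc - na - nb"

lemma c_eq: "c v = l *s v + w v - a v - b v"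
  using sum_eq[of v] by (simp add: algebra_simps)

lemma z_eq: "z v = k *s v + d *s c v + r v"
proof -
  \<comment> \<open>The norm of \<open>s = a + b\<close> is computed twice: from \<open>a\<close>
    and \<open>b\<close> it is \<open>z + na + nb\<close>, from \<open>l + w - c\<close> it yields
    \<open>k\<close>, \<open>d\<close> and \<open>r\<close>.\<close>
  define s where "s v = a v + b v" for v
  have s: "s v = l *s v + w v - c v" for v using sum_eq[of v] by (simp add: s_def algebra_simps)
  have "(ta + tb) *s s v - s (s v) = z v + (na + nb) *s v"
    unfolding s_def z_def by (simp add: ls aa bb algebra_simps)
  moreover have "(ta + tb) *s s v - s (s v) = (k + na + nb) *s v + d *s c v + r v"
    unfolding s k_def d_def r_def
    by (simp add: ls cc algebra_simps) (simp only: mult_2_right scale_left_distrib ac_simps)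
  ultimately have "z v + (na + nb) *s v = (k + na + nb) *s v + d *s c v + r v" by (rule trans[OF sym])
  then show ?thesis by (simp add: scale_left_distrib add.assoc add.left_commute)
qed

lemma fin_rank_r: "fin_rank r"
  unfolding r_def[abs_def] by (intro fin_rank_intros fin_rank_w fin_rank_lin_comp[OF lin_c fin_rank_w]
    fin_rank_comp[OF fin_rank_w])

lemma lin_r: "lin r"
  unfolding lin_iff r_def by (simp add: ls algebra_simps)

text \<open>This is a quadratic polynomial evaluated at \<open>z\<close>, chosen to annihilate
  \<open>k + d c\<close>: its formal roots are \<open>k + d c\<close> and
  \<open>k + d (tc - c)\<close>. As \<open>z\<close> differs from \<open>k + d c\<close> by
  \<open>r\<close>, only terms containing \<open>r\<close> survive.\<close>

definition s :: "'v \<Rightarrow> 'v"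
  where "s v = z (z v) - (k + k + tc * d) *s z v + (k * k + tc * d * k + nc * d * d) *s v"

lemma s_eq: "s v = d *s c (r v) + d *s r (c v) + r (r v) - (tc * d) *s r v"
  unfolding s_def z_eq
  by (simp add: ls lin_simps[OF lin_r] cc algebra_simps)
    (simp only: mult_2 scale_left_distrib ac_simps)

lemma fin_rank_s: "fin_rank s"
  unfolding s_eq[abs_def] by (intro fin_rank_intros fin_rank_r fin_rank_lin_comp[OF lin_c fin_rank_r]
    fin_rank_comp[OF fin_rank_r])

lemma lin_s: "lin s"
  unfolding lin_iff s_def by (simp add: lin_simps[OF lin_z] algebra_simps)

lemma s_a: "s (a v) = a (s v)" and s_b: "s (b v) = b (s v)"
  unfolding s_def by (simp_all add: ls z_a z_b)

text \<open>Words in \<open>a\<close> and \<open>b\<close> reduce to \<open>1, a, b, a b\<close>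
  with coefficients polynomial in \<open>z\<close>, and modulo the range of \<open>s\<close> powers
  of \<open>z\<close> reduce to \<open>1, z\<close>. Stability under \<open>c\<close> follows from
  \<open>c = l + w - a - b\<close>.\<close>

lemma finite_stable:
  assumes "finite G" and "range w \<subseteq> span G"
  obtains S where "finite S" "G \<subseteq> S" "\<forall>x\<in>span S. a x \<in> span S"
    "\<forall>x\<in>span S. b x \<in> span S" "\<forall>x\<in>span S. c x \<in> span S"
proof -
  obtain T where T: "finite T" "span T = range s" using fin_rank_range[OF lin_s fin_rank_s] .
  define H where "H = G \<union> z ` G"
  define S where "S = H \<union> a ` H \<union> b ` H \<union> (\<lambda>v. a (b v)) ` H \<union> T"
  note spans = span_add span_diff span_scale
  have HS: "h \<in> span S" "a h \<in> span S" "b h \<in> span S" "a (b h) \<in> span S" if "h \<in> H" for h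
    using that unfolding S_def by (auto intro!: span_base)
  have TS: "span T \<subseteq> span S" unfolding S_def by (auto intro!: span_mono)
  have "a t \<in> span T" if "t \<in> span T" for t
    using that unfolding T(2) by (auto simp flip: s_a)
  then have aT: "a t \<in> span S" if "t \<in> T" for t using that TS span_base by blast
  have "b t \<in> span T" if "t \<in> span T" for t
    using that unfolding T(2) by (auto simp flip: s_b)
  then have bT: "b t \<in> span S" if "t \<in> T" for t using that TS span_base by blast
  \<comment> \<open>Solving the definition of \<open>s\<close> for \<open>z (z g)\<close> expresses
    it through \<open>z g\<close>, \<open>g\<close> and an element of the range of
    \<open>s\<close>.\<close>
  have zH: "z h \<in> span (H \<union> T)" if "h \<in> H" for h
    using that unfolding H_def
  proof
    assume "h \<in> G"
    then show "z h \<in> span (G \<union> z ` G \<union> T)" by (auto intro: span_base)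
  next
    assume "h \<in> z ` G"
    then obtain g where g: "g \<in> G" "h = z g" by blast
    have "z h = s g + (k + k + tc * d) *s z g - (k * k + tc * d * k + nc * d * d) *s g"
      unfolding g s_def by simp
    moreover have "s g \<in> span T" unfolding T(2) by blast
    then have "s g \<in> span (G \<union> z ` G \<union> T)" using span_mono[of T "G \<union> z ` G \<union> T"] by blast
    moreover have "g \<in> span (G \<union> z ` G \<union> T)" "z g \<in> span (G \<union> z ` G \<union> T)"
      using g by (auto intro!: span_base)
    ultimately show "z h \<in> span (G \<union> z ` G \<union> T)" by (simp only: spans)
  qed
  have zS: "z h \<in> span S" if "h \<in> H" for h
    using zH[OF that] span_mono[of "H \<union> T" S] unfolding S_def by blast
  \<comment> \<open>Needed for \<open>b (a (b h))\<close>, where exchanging \<open>b\<close> and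
    \<open>a\<close> produces \<open>z (b h) = b (z h)\<close>.\<close>
  have bzS: "b (z h) \<in> span S" if "h \<in> H" for h
    by (rule span_image_subset[OF lin_b _ zH[OF that]]) (use HS bT in blast)
  have ba: "b (a v) = tb *s a v + ta *s b v - a (b v) - z v" for v
    unfolding z_def by simp
  have a: "a x \<in> span S" if "x \<in> span S" for x
  proof (rule span_image_subset[OF lin_a _ that])
    fix x assume "x \<in> S"
    then have "x \<in> H \<or> (\<exists>h\<in>H. x = a h \<or> x = b h \<or> x = a (b h)) \<or> x \<in> T"
      unfolding S_def by blast
    then show "a x \<in> span S"
      by (auto simp: aa HS aT intro!: spans)
  qed
  have b: "b x \<in> span S" if "x \<in> span S" for x
  proof (rule span_image_subset[OF lin_b _ that])
    fix x assume "x \<in> S"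
    then have "x \<in> H \<or> (\<exists>h\<in>H. x = a h \<or> x = b h \<or> x = a (b h)) \<or> x \<in> T"
      unfolding S_def by blast
    then show "b x \<in> span S"
      by (auto simp: ba bb z_b ls HS bT zS bzS intro!: spans)
  qed
  have GS: "G \<subseteq> S" unfolding S_def H_def by blast
  have w: "w x \<in> span S" for x using assms(2) span_mono[OF GS] by blast
  have "c x \<in> span S" if "x \<in> span S" for x
    unfolding c_eq using a[OF that] b[OF that] w that by (intro spans)
  moreover have "finite S" unfolding S_def H_def using assms(1) T(1) by simp
  ultimately show thesis using that GS a b by blast
qed

section \<open>The scalar condition when \<open>d\<close> is nonzero\<close>

text \<open>Dividing by \<open>d\<close> makes \<open>c\<close> an affine function of
  \<open>z\<close> modulo finite rank, and \<open>z\<close> commutes with \<open>a\<close> and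
  \<open>b\<close>.\<close>

lemma commute_mod_fin_rank:
  assumes "d \<noteq> 0"
  shows "fin_rank (\<lambda>v. a (c v) - c (a v))" "fin_rank (\<lambda>v. b (c v) - c (b v))"
    "fin_rank (\<lambda>v. a (b v) - b (a v))"
proof -
  have c: "c v = inverse d *s (z v - k *s v - r v)" for v
    using assms by (simp add: z_eq)
  have ac: "a (c v) - c (a v) = inverse d *s (r (a v) - a (r v))" for v
    unfolding c[of v] c[of "a v"] by (simp add: ls z_a flip: scale_right_diff_distrib)
  have bc: "b (c v) - c (b v) = inverse d *s (r (b v) - b (r v))" for v
    unfolding c[of v] c[of "b v"] by (simp add: ls z_b flip: scale_right_diff_distrib)
  have ra: "fin_rank (\<lambda>v. r (a v) - a (r v))" and rb: "fin_rank (\<lambda>v. r (b v) - b (r v))"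
    by (intro fin_rank_intros fin_rank_lin_comp[OF lin_a fin_rank_r]
      fin_rank_lin_comp[OF lin_b fin_rank_r] fin_rank_comp[OF fin_rank_r])+
  show 1: "fin_rank (\<lambda>v. a (c v) - c (a v))" unfolding ac by (rule fin_rank_scale[OF ra])
  show "fin_rank (\<lambda>v. b (c v) - c (b v))" unfolding bc by (rule fin_rank_scale[OF rb])
  \<comment> \<open>As \<open>b = l + w - a - c\<close>, the commutator of \<open>a\<close> with
    \<open>b\<close> is its commutator with \<open>w\<close> minus that with
    \<open>c\<close>.\<close>
  have ab: "a (b v) - b (a v) = a (w v) - w (a v) - (a (c v) - c (a v))" for v
    unfolding c_eq by (simp add: ls algebra_simps)
  show "fin_rank (\<lambda>v. a (b v) - b (a v))"
    unfolding ab by (intro fin_rank_diff 1 fin_rank_lin_comp[OF lin_a fin_rank_w]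
      fin_rank_comp[OF fin_rank_w])
qed

text \<open>Starting from the identity, three passes through \<open>eigenvalue_mod_fin_rank\<close>
  give an \<open>e3\<close> of infinite rank on which \<open>a\<close>, \<open>b\<close>,
  \<open>c\<close> all act as roots modulo finite rank; evaluating the sum on \<open>e3\<close>
  compares the scalars.\<close>

lemma scalar_sum:
  assumes infin: "\<not> fin_rank (\<lambda>v. v)" and "d \<noteq> 0"
    and ta: "ta = x1 + y1" "na = x1 * y1" and tb: "tb = x2 + y2" "nb = x2 * y2"
    and tc: "tc = x3 + y3" "nc = x3 * y3"
  shows "\<exists>u1\<in>{x1, y1}. \<exists>u2\<in>{x2, y2}. \<exists>u3\<in>{x3, y3}. l = u1 + u2 + u3"
proof -
  note comm = commute_mod_fin_rank[OF \<open>d \<noteq> 0\<close>]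
  obtain u1 e1 where u1: "u1 \<in> {x1, y1}" "lin e1" "\<not> fin_rank e1" "fin_rank (\<lambda>v. a (e1 v) - u1 *s e1 v)"
    "\<forall>g m. lin g \<longrightarrow> fin_rank (\<lambda>v. g (a v) - a (g v)) \<longrightarrow> fin_rank (\<lambda>v. g v - m *s v) \<longrightarrow>
      fin_rank (\<lambda>v. g (e1 v) - m *s e1 v)"
    using eigenvalue_mod_fin_rank[OF lin_a aa[unfolded ta] lin_ident infin] .
  obtain u2 e2 where u2: "u2 \<in> {x2, y2}" "lin e2" "\<not> fin_rank e2" "fin_rank (\<lambda>v. b (e2 v) - u2 *s e2 v)"
    "\<forall>g m. lin g \<longrightarrow> fin_rank (\<lambda>v. g (b v) - b (g v)) \<longrightarrow> fin_rank (\<lambda>v. g (e1 v) - m *s e1 v) \<longrightarrow>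
      fin_rank (\<lambda>v. g (e2 v) - m *s e2 v)"
    using eigenvalue_mod_fin_rank[OF lin_b bb[unfolded tb] u1(2,3)] .
  obtain u3 e3 where u3: "u3 \<in> {x3, y3}" "lin e3" "\<not> fin_rank e3" "fin_rank (\<lambda>v. c (e3 v) - u3 *s e3 v)"
    "\<forall>g m. lin g \<longrightarrow> fin_rank (\<lambda>v. g (c v) - c (g v)) \<longrightarrow> fin_rank (\<lambda>v. g (e2 v) - m *s e2 v) \<longrightarrow>
      fin_rank (\<lambda>v. g (e3 v) - m *s e3 v)"
    using eigenvalue_mod_fin_rank[OF lin_c cc[unfolded tc] u2(2,3)] .
  \<comment> \<open>The relation for \<open>a\<close> is carried from \<open>e1\<close> through
    \<open>e2\<close> to \<open>e3\<close>, that for \<open>b\<close> from \<open>e2\<close> to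
    \<open>e3\<close>.\<close>
  have "fin_rank (\<lambda>v. a (e3 v) - u1 *s e3 v)" "fin_rank (\<lambda>v. b (e3 v) - u2 *s e3 v)"
    using u3(5)[rule_format, OF lin_a comm(1) u2(5)[rule_format, OF lin_a comm(3) u1(4)]]
      u3(5)[rule_format, OF lin_b comm(2) u2(4)] .
  note e3 = this u3(4)
  have "(l - (u1 + u2 + u3)) *s e3 v = (a (e3 v) - u1 *s e3 v) + (b (e3 v) - u2 *s e3 v)
      + (c (e3 v) - u3 *s e3 v) - w (e3 v)" for v
    using sum_eq[of "e3 v"] by (simp add: algebra_simps)
  then have "fin_rank (\<lambda>v. (l - (u1 + u2 + u3)) *s e3 v)"
    by (simp only:) (intro fin_rank_diff[OF fin_rank_add[OF fin_rank_add]] e3 fin_rank_comp[OF fin_rank_w])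
  then have "l = u1 + u2 + u3" using fin_rank_scale_cancel u3(3) by fastforce
  then show ?thesis using u1(1) u2(1) u3(1) by blast
qed

end

subsection \<open>Matrices of endomorphisms\<close>

text \<open>Here \<open>t\<close> and \<open>n\<close> stand for the sum and the product of the two
  roots; the leading coefficient is divided out.\<close>

definition quad_mat :: "'a::field \<Rightarrow> 'a \<Rightarrow> 'a mat \<Rightarrow> bool"
  where "quad_mat t n M \<longleftrightarrow> M * M = t \<cdot>\<^sub>m M - n \<cdot>\<^sub>m 1\<^sub>m (dim_row M)"

lemma split_deg2_cases:
  fixes p :: "'a::field poly"
  assumes "split_deg2 p"
  obtains m x y where "m \<noteq> 0" "p = [:m * (x * y), - (m * (x + y)), m:]"
proof -
  obtain x y where "degree p = 2" and p: "p = Polynomial.smult (lead_coeff p) ([:-x, 1:] * [:-y, 1:])"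
    using assms unfolding split_deg2_def by blast
  then have "lead_coeff p \<noteq> 0" by auto
  moreover have "p = [:lead_coeff p * (x * y), - (lead_coeff p * (x + y)), lead_coeff p:]"
    by (subst p) (simp add: algebra_simps)
  ultimately show thesis using that by blast
qed

lemma split_quadratic:
  fixes m x y :: "'a::field"
  assumes "m \<noteq> 0" and p: "p = [:m * (x * y), - (m * (x + y)), m:]"
  shows poly_trace_split: "poly_trace p = x + y"
    and poly_split_eq_0: "poly p u = 0 \<longleftrightarrow> u \<in> {x, y}"
    and mat_poly_split_eq_0: "M \<in> carrier_mat n n \<Longrightarrow> mat_poly p M = 0\<^sub>m n n \<longleftrightarrow> quad_mat (x + y) (x * y) M"
proof -
  have deg: "degree p = 2" using assms by simp
  show "poly_trace p = x + y"
    using assms by (simp add: poly_trace_def deg numeral_2_eq_2)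
  have "poly p u = m * ((u - x) * (u - y))" unfolding p by (simp add: algebra_simps)
  then show "poly p u = 0 \<longleftrightarrow> u \<in> {x, y}" using assms(1) by auto
  assume M: "M \<in> carrier_mat n n"
  have pow: "M ^\<^sub>m Suc (Suc 0) = M * M" using M by simp
  have c: "coeff p 0 = m * (x * y)" "coeff p (Suc 0) = - (m * (x + y))" "coeff p (Suc (Suc 0)) = m"
    unfolding p by simp_all
  have mp: "mat_poly p M = m * (x * y) \<cdot>\<^sub>m 1\<^sub>m n + (- (m * (x + y)) \<cdot>\<^sub>m M + (m \<cdot>\<^sub>m (M * M) + 0\<^sub>m n n))"
    unfolding mat_poly_def deg using M by (simp add: numeral_2_eq_2 c pow)
  have e: "mat_poly p M $$ (i, j) = m * ((M * M) $$ (i, j) - ((x + y) \<cdot>\<^sub>m M - (x * y) \<cdot>\<^sub>m 1\<^sub>m n) $$ (i, j))"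
    if "i < n" "j < n" for i j
    using M that unfolding mp by (simp add: algebra_simps del: index_mult_mat(1))
  have dim: "dim_row M = n" "dim_col M = n" using M by auto
  show "mat_poly p M = 0\<^sub>m n n \<longleftrightarrow> quad_mat (x + y) (x * y) M"
  proof
    assume "mat_poly p M = 0\<^sub>m n n"
    then have "m * ((M * M) $$ (i, j) - ((x + y) \<cdot>\<^sub>m M - (x * y) \<cdot>\<^sub>m 1\<^sub>m n) $$ (i, j)) = 0"
      if "i < n" "j < n" for i j using e[OF that] that by simp
    then show "quad_mat (x + y) (x * y) M"
      unfolding quad_mat_def using dim assms(1) by (intro eq_matI) (simp_all del: index_mult_mat(1))
  next
    assume "quad_mat (x + y) (x * y) M"
    then have "mat_poly p M $$ (i, j) = 0" if "i < n" "j < n" for i j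
      using e[OF that] dim unfolding quad_mat_def by simp
    then show "mat_poly p M = 0\<^sub>m n n"
      using M by (intro eq_matI) (simp_all add: mp)
  qed
qed

section \<open>Quadratic endomorphisms and coordinates along a list of vectors\<close>

context endomorphisms
begin

definition quad :: "'a \<Rightarrow> 'a \<Rightarrow> ('v \<Rightarrow> 'v) \<Rightarrow> bool"
  where "quad t n u \<longleftrightarrow> (\<forall>v. u (u v) = t *s u v - n *s v)"

lemma endo_poly_split_eq_0:
  assumes "m \<noteq> 0" and p: "p = [:m * (x * y), - (m * (x + y)), m:]"
  shows "(\<forall>v. endo_poly scale p u v = 0) \<longleftrightarrow> quad (x + y) (x * y) u"
proof -
  have "degree p = 2" using assms by simp
  then have "endo_poly scale p u v = m *s (u (u v) - ((x + y) *s u v - (x * y) *s v))" for v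
    unfolding endo_poly_def using p by (simp add: numeral_2_eq_2 algebra_simps)
  then show ?thesis using assms(1) by (simp add: quad_def)
qed

lemma list_sum_set:
  assumes "distinct cs"
  shows "(\<Sum>i<length cs. h (cs ! i)) = sum h (set cs)"
proof -
  have "bij_betw ((!) cs) {..<length cs} (set cs)" using bij_betw_nth[OF assms] by simp
  then show ?thesis by (rule sum.reindex_bij_betw)
qed

lemma list_coeff_0:
  assumes "distinct cs" and "independent (set cs)" and "(\<Sum>i<length cs. h i *s (cs ! i)) = 0"
    and "i < length cs"
  shows "h i = 0"
proof -
  define g where "g = the_inv_into {..<length cs} ((!) cs)"
  have g: "g (cs ! j) = j" if "j < length cs" for j
    unfolding g_def using assms(1) that
    by (intro the_inv_into_f_f) (auto simp: inj_on_nth)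
  have "(\<Sum>v\<in>set cs. h (g v) *s v) = 0"
    unfolding list_sum_set[OF assms(1), symmetric] using assms(3) by (simp add: g)
  then have "h (g (cs ! i)) = 0"
    by (intro independentD[OF assms(2), of "set cs"]) (use assms(4) in auto)
  then show ?thesis using g assms(4) by simp
qed

lemma list_coeff_unique:
  assumes "distinct cs" and "independent (set cs)"
    and "(\<Sum>i<length cs. f i *s (cs ! i)) = (\<Sum>i<length cs. g i *s (cs ! i))" and "i < length cs"
  shows "f i = g i"
  using list_coeff_0[OF assms(1,2) _ assms(4), of "\<lambda>i. f i - g i"] assms(3)
  by (simp add: scale_left_diff_distrib sum_subtractf)

lemma list_coeff_exists:
  assumes "distinct cs" and "x \<in> span (set cs)"
  obtains f where "x = (\<Sum>i<length cs. f i *s (cs ! i))"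
proof -
  obtain h where "x = (\<Sum>v\<in>set cs. h v *s v)" using assms(2) span_finite[of "set cs"] by auto
  then show thesis using that[of "\<lambda>i. h (cs ! i)"] list_sum_set[OF assms(1), of "\<lambda>v. h v *s v"] by simp
qed

text \<open>Columns hold the coordinates of images, as in \<open>in_class\<close>. Only values of
  \<open>u\<close> on the list enter, so a restriction to a stable subspace needs no object of its
  own.\<close>

definition rep :: "'v list \<Rightarrow> ('v \<Rightarrow> 'v) \<Rightarrow> 'a mat \<Rightarrow> bool"
  where "rep cs u M \<longleftrightarrow> M \<in> carrier_mat (length cs) (length cs) \<and>
    (\<forall>j<length cs. u (cs ! j) = (\<Sum>i<length cs. M $$ (i, j) *s (cs ! i)))"

lemma rep_unique:
  assumes "distinct cs" and "independent (set cs)" and "rep cs u M" and "rep cs u' N"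
    and "\<And>x. x \<in> set cs \<Longrightarrow> u x = u' x"
  shows "M = N"
proof (rule eq_matI)
  fix i j assume "i < dim_row N" "j < dim_col N"
  then have ij: "i < length cs" "j < length cs" using assms(4) unfolding rep_def by auto
  then show "M $$ (i, j) = N $$ (i, j)"
    using assms(3,4) assms(5)[of "cs ! j"] unfolding rep_def
    by (intro list_coeff_unique[OF assms(1,2) _ ij(1), of "\<lambda>i. M $$ (i, j)" "\<lambda>i. N $$ (i, j)"]) auto
qed (use assms(3,4) in \<open>auto simp: rep_def\<close>)

lemma rep_exists:
  assumes "distinct cs" and "\<And>x. x \<in> set cs \<Longrightarrow> u x \<in> span (set cs)"
  shows "\<exists>M. rep cs u M"
proof -
  have "\<forall>j\<in>{..<length cs}. \<exists>f. u (cs ! j) = (\<Sum>i<length cs. f i *s (cs ! i))"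
    using list_coeff_exists[OF assms(1)] assms(2) by (metis lessThan_iff nth_mem)
  then obtain f where "\<And>j. j < length cs \<Longrightarrow> u (cs ! j) = (\<Sum>i<length cs. f j i *s (cs ! i))"
    unfolding bchoice_iff by auto
  then have "rep cs u (mat (length cs) (length cs) (\<lambda>(i, j). f j i))"
    by (auto simp: rep_def)
  then show ?thesis by (rule exI)
qed

lemma rep_add:
  assumes "rep cs u M" and "rep cs u' N"
  shows "rep cs (\<lambda>v. u v + u' v) (M + N)"
  using assms by (auto simp: rep_def scale_left_distrib sum.distrib)

lemma rep_diff:
  assumes "rep cs u M" and "rep cs u' N"
  shows "rep cs (\<lambda>v. u v - u' v) (M - N)"
  using assms by (auto simp: rep_def scale_left_diff_distrib sum_subtractf)

lemma rep_scale:
  assumes "rep cs u M"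
  shows "rep cs (\<lambda>v. c *s u v) (c \<cdot>\<^sub>m M)"
  using assms by (auto simp: rep_def scale_sum_right)

lemma rep_ident: "rep cs (\<lambda>v. v) (1\<^sub>m (length cs))"
proof -
  have "(\<Sum>i<length cs. 1\<^sub>m (length cs) $$ (i, j) *s (cs ! i)) = (\<Sum>i<length cs. if i = j then cs ! i else 0)"
    if "j < length cs" for j
    using that by (intro sum.cong) auto
  then show ?thesis by (simp add: rep_def)
qed

lemma rep_comp:
  assumes "lin u" and "rep cs u M" and "rep cs u' N"
  shows "rep cs (\<lambda>v. u (u' v)) (M * N)"
proof -
  have dim: "M \<in> carrier_mat (length cs) (length cs)" "N \<in> carrier_mat (length cs) (length cs)"
    using assms unfolding rep_def by auto
  have "u (u' (cs ! j)) = (\<Sum>i<length cs. (M * N) $$ (i, j) *s (cs ! i))" if j: "j < length cs" for j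
  proof -
    have "u (u' (cs ! j)) = (\<Sum>k<length cs. N $$ (k, j) *s u (cs ! k))"
      using assms(3) j by (simp add: rep_def endo.linear_sum[OF assms(1)] lin_simps[OF assms(1)])
    also have "\<dots> = (\<Sum>k<length cs. \<Sum>i<length cs. (M $$ (i, k) * N $$ (k, j)) *s (cs ! i))"
      using assms(2) by (simp add: rep_def scale_sum_right mult.commute)
    also have "\<dots> = (\<Sum>i<length cs. \<Sum>k<length cs. (M $$ (i, k) * N $$ (k, j)) *s (cs ! i))"
      by (rule sum.swap)
    also have "\<dots> = (\<Sum>i<length cs. (M * N) $$ (i, j) *s (cs ! i))"
      using dim j by (intro sum.cong refl) (simp add: scalar_prod_def scale_sum_left atLeast0LessThan)
    finally show ?thesis .
  qed
  then show ?thesis using dim by (auto simp: rep_def)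
qed

text \<open>The two sides of the quadratic equation are represented by the two sides of the matrix
  equation, and representing matrices are unique.\<close>

lemma quad_rep:
  assumes "distinct cs" and "independent (set cs)" and "lin u" and "rep cs u M"
  shows "quad_mat t n M \<longleftrightarrow> (\<forall>x\<in>set cs. u (u x) = t *s u x - n *s x)"
proof -
  have M: "dim_row M = length cs" using assms(4) unfolding rep_def by auto
  have 1: "rep cs (\<lambda>v. u (u v)) (M * M)" by (rule rep_comp[OF assms(3,4,4)])
  have 2: "rep cs (\<lambda>v. t *s u v - n *s v) (t \<cdot>\<^sub>m M - n \<cdot>\<^sub>m 1\<^sub>m (length cs))"
    by (intro rep_diff rep_scale assms rep_ident)
  show ?thesis
  proof
    assume "quad_mat t n M"
    then have "rep cs (\<lambda>v. t *s u v - n *s v) (M * M)" using 2 M unfolding quad_mat_def by simp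
    with 1 show "\<forall>x\<in>set cs. u (u x) = t *s u x - n *s x"
      by (auto simp: rep_def in_set_conv_nth)
  next
    assume "\<forall>x\<in>set cs. u (u x) = t *s u x - n *s x"
    then show "quad_mat t n M"
      unfolding quad_mat_def M by (intro rep_unique[OF assms(1,2) 1 2]) blast
  qed
qed

text \<open>On the added vectors \<open>w\<close> vanishes, so only the scalar \<open>l\<close>
  remains in their columns.\<close>

lemma rep_extend_kernel:
  assumes "rep bs w A" and "\<And>x. x \<in> set ds \<Longrightarrow> w x = 0"
  shows "rep (bs @ ds) (\<lambda>v. l *s v + w v)
    (four_block_mat (A + l \<cdot>\<^sub>m 1\<^sub>m (dim_row A)) (0\<^sub>m (dim_row A) (length ds))
      (0\<^sub>m (length ds) (dim_row A)) (l \<cdot>\<^sub>m 1\<^sub>m (length ds)))" (is "rep _ _ ?M")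
proof -
  let ?n = "length bs" and ?q = "length ds"
  have A: "A \<in> carrier_mat ?n ?n" using assms(1) unfolding rep_def by blast
  then have dim: "dim_row A = ?n" "dim_col A = ?n" by auto
  have M: "?M \<in> carrier_mat (?n + ?q) (?n + ?q)" using A by (auto simp: dim)
  have split: "(\<Sum>i<?n + ?q. h i *s ((bs @ ds) ! i)) = (\<Sum>i<?n. h i *s (bs ! i)) + (\<Sum>i<?q. h (?n + i) *s (ds ! i))" for h
  proof -
    have "sum g {..<n + m} = sum g {..<n} + (\<Sum>i<m. g (n + i))" for g :: "nat \<Rightarrow> 'v" and n m
      by (induction m) (simp_all add: add.assoc)
    from this[of "\<lambda>i. h i *s ((bs @ ds) ! i)" ?n ?q] show ?thesis by (simp add: nth_append)
  qed
  have "l *s ((bs @ ds) ! j) + w ((bs @ ds) ! j) = (\<Sum>i<?n + ?q. ?M $$ (i, j) *s ((bs @ ds) ! i))"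
    if j: "j < ?n + ?q" for j
  proof (cases "j < ?n")
    case True
    have "(\<Sum>i<?n. ?M $$ (i, j) *s (bs ! i)) = (\<Sum>i<?n. A $$ (i, j) *s (bs ! i) + (if i = j then l *s (bs ! i) else 0))"
      using True dim by (intro sum.cong) (auto simp: scale_left_distrib)
    also have "\<dots> = w (bs ! j) + l *s (bs ! j)"
      using assms(1) True by (simp add: rep_def sum.distrib)
    moreover have "(\<Sum>i<?q. ?M $$ (?n + i, j) *s (ds ! i)) = 0"
      using True dim by (intro sum.neutral) auto
    ultimately show ?thesis unfolding split using True by (simp add: nth_append add.commute)
  next
    case False
    then have jq: "j - ?n < ?q" using j by simp
    have "(\<Sum>i<?n. ?M $$ (i, j) *s (bs ! i)) = 0"
      using False j dim by (intro sum.neutral) auto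
    moreover have "(\<Sum>i<?q. ?M $$ (?n + i, j) *s (ds ! i)) = (\<Sum>i<?q. if i = j - ?n then l *s (ds ! i) else 0)"
      using False j dim by (intro sum.cong) auto
    ultimately show ?thesis unfolding split using False jq assms(2)[of "ds ! (j - ?n)"] by (simp add: nth_append)
  qed
  then show ?thesis using M unfolding rep_def by simp
qed

lemma quad_on_basis:
  assumes "lin u" and "span B = UNIV" and "\<And>x. x \<in> B \<Longrightarrow> u (u x) = t *s u x - n *s x"
  shows "quad t n u"
proof -
  have "lin (\<lambda>v. u (u v))" "lin (\<lambda>v. t *s u v - n *s v)"
    by (simp_all add: lin_iff lin_simps[OF assms(1)] algebra_simps)
  from endo.linear_eq_on[OF this, of _ B] show ?thesis
    using assms(2,3) unfolding quad_def by simp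
qed

subsection \<open>Extension and restriction along the kernel\<close>

lemma in_class_basis:
  assumes "in_class scale w A"
  obtains bs where "distinct bs" "independent (set bs)" "range w \<subseteq> span (set bs)"
    "\<forall>v. \<exists>x\<in>span (set bs). \<exists>y. w y = 0 \<and> v = x + y" "rep bs w A"
proof -
  obtain W bs where "minimal_adapted_subspace scale w W" and bs: "distinct bs" "independent (set bs)"
    "span (set bs) = W" "A \<in> carrier_mat (length bs) (length bs)"
    "\<forall>j<length bs. w (bs ! j) = (\<Sum>i<length bs. scale (A $$ (i, j)) (bs ! i))"
    using assms unfolding in_class_def by (elim exE conjE)
  then have "adapted_subspace scale w W" unfolding minimal_adapted_subspace_def by simp
  then have "range w \<subseteq> span (set bs)" "\<forall>v. \<exists>x\<in>span (set bs). \<exists>y. w y = 0 \<and> v = x + y"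
    unfolding adapted_subspace_def bs(3) by simp_all
  then show thesis using that bs by (simp add: rep_def)
qed

text \<open>As \<open>V\<close> is the span of \<open>bs\<close> plus the kernel of
  \<open>w\<close>, the modular law writes \<open>F\<close> as that span plus the part of the kernel
  inside \<open>F\<close>. It is used for a finite-dimensional stable \<open>F\<close> and for
  \<open>F = V\<close>.\<close>

lemma extend_basis_by_kernel:
  assumes w: "lin w" and bs: "independent (set bs)"
    "\<forall>v. \<exists>x\<in>span (set bs). \<exists>y. w y = 0 \<and> v = x + y"
    and F: "subspace F" "set bs \<subseteq> F"
  obtains B where "set bs \<subseteq> B" "independent B" "span B = F" "\<forall>x\<in>B - set bs. w x = 0"
proof -
  let ?V = "set bs \<union> {y \<in> F. w y = 0}"
  obtain B where B: "set bs \<subseteq> B" "B \<subseteq> ?V" "independent B" "?V \<subseteq> span B"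
    using maximal_independent_subset_extend[of "set bs" ?V] bs(1) by blast
  have bsF: "span (set bs) \<subseteq> F" using span_minimal[OF F(2,1)] .
  have "F \<subseteq> span B"
  proof
    fix v assume v: "v \<in> F"
    obtain x y where xy: "x \<in> span (set bs)" "w y = 0" "v = x + y" using bs(2) by blast
    then have "y = v - x" by simp
    then have "y \<in> F" using v bsF xy(1) F(1) subspace_diff by blast
    then have "y \<in> span B" using B(4) xy(2) by blast
    moreover have "x \<in> span B" using span_mono[OF B(1)] xy(1) by blast
    ultimately show "v \<in> span B" unfolding xy(3) by (rule span_add[rotated])
  qed
  moreover have "B \<subseteq> F" using B(2) F(2) by blast
  then have "span B \<subseteq> F" by (rule span_minimal[OF _ F(1)])
  ultimately have "span B = F" by blast
  moreover have "\<forall>x\<in>B - set bs. w x = 0" using B(2) by blast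
  ultimately show thesis using that[OF B(1,3)] by simp
qed

section \<open>From endomorphisms to block matrices\<close>

lemma block_matrix_of_psum:
  assumes w: "lin w" and A: "in_class scale w A"
    and lin: "lin a" "lin b" "lin c"
    and quad: "quad ta na a" "quad tb nb b" "quad tc nc c"
    and sum: "\<And>v. l *s v + w v = a v + b v + c v" and fr: "fin_rank w"
  obtains q M1 M2 M3 where
    "four_block_mat (A + l \<cdot>\<^sub>m 1\<^sub>m (dim_row A)) (0\<^sub>m (dim_row A) q)
      (0\<^sub>m q (dim_row A)) (l \<cdot>\<^sub>m 1\<^sub>m q) = M1 + M2 + M3"
    "M1 \<in> carrier_mat (dim_row A + q) (dim_row A + q)" "M2 \<in> carrier_mat (dim_row A + q) (dim_row A + q)"
    "M3 \<in> carrier_mat (dim_row A + q) (dim_row A + q)"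
    "quad_mat ta na M1" "quad_mat tb nb M2" "quad_mat tc nc M3"
proof -
  obtain bs where bs: "distinct bs" "independent (set bs)" "range w \<subseteq> span (set bs)"
    "\<forall>v. \<exists>x\<in>span (set bs). \<exists>y. w y = 0 \<and> v = x + y" "rep bs w A"
    by (rule in_class_basis[OF A])
  interpret quadratic_triple scale a b c w ta na tb nb tc nc l
    by (intro quadratic_triple.intro quadratic_triple_axioms.intro endomorphisms_axioms w lin fr
        sum[symmetric] quad[unfolded quad_def, rule_format])
  obtain S where S: "finite S" "set bs \<subseteq> S" "\<forall>x\<in>span S. a x \<in> span S"
    "\<forall>x\<in>span S. b x \<in> span S" "\<forall>x\<in>span S. c x \<in> span S"
    by (rule finite_stable[OF finite_set bs(3)])
  have bsS: "set bs \<subseteq> span S" using S(2) span_superset by (rule order_trans)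
  \<comment> \<open>The number of kernel vectors added here is the size \<open>q\<close> of the
    scalar block.\<close>
  obtain B where B: "set bs \<subseteq> B" "independent B" "span B = span S" "\<forall>x\<in>B - set bs. w x = 0"
    by (rule extend_basis_by_kernel[OF w bs(2,4) subspace_span bsS])
  have "finite B" using independent_span_bound[OF S(1) B(2)] B(3) span_superset by blast
  then obtain ds where ds: "set ds = B - set bs" "distinct ds"
    using finite_distinct_list[of "B - set bs"] by blast
  let ?cs = "bs @ ds"
  have cs: "set ?cs = B" "distinct ?cs" using ds B(1) bs(1) by auto
  have ind: "independent (set ?cs)" unfolding cs by (rule B(2))
  have inS: "x \<in> span S" if "x \<in> set ?cs" for x using that unfolding cs B(3)[symmetric] by (rule span_base)
  have spS: "span (set ?cs) = span S" unfolding cs by (rule B(3))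
  have ex_rep: "\<exists>M. rep ?cs u M" if u: "\<forall>x\<in>span S. u x \<in> span S" for u
  proof -
    have "u x \<in> span (set ?cs)" if "x \<in> set ?cs" for x
      unfolding spS using u inS[OF that] ..
    then show ?thesis by (rule rep_exists[OF cs(2)])
  qed
  obtain M1 where M1: "rep ?cs a M1"
    using ex_rep[OF S(3)] ..
  obtain M2 where M2: "rep ?cs b M2"
    using ex_rep[OF S(4)] ..
  obtain M3 where M3: "rep ?cs c M3"
    using ex_rep[OF S(5)] ..
  have dA: "dim_row A = length bs" using bs(5) unfolding rep_def by auto
  have "rep ?cs (\<lambda>v. l *s v + w v) (four_block_mat (A + l \<cdot>\<^sub>m 1\<^sub>m (dim_row A)) (0\<^sub>m (dim_row A) (length ds))
      (0\<^sub>m (length ds) (dim_row A)) (l \<cdot>\<^sub>m 1\<^sub>m (length ds)))"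
    by (rule rep_extend_kernel[OF bs(5)]) (use ds(1) B(4) in blast)
  then have "four_block_mat (A + l \<cdot>\<^sub>m 1\<^sub>m (dim_row A)) (0\<^sub>m (dim_row A) (length ds))
      (0\<^sub>m (length ds) (dim_row A)) (l \<cdot>\<^sub>m 1\<^sub>m (length ds)) = M1 + M2 + M3"
    by (rule rep_unique[OF cs(2) ind _ rep_add[OF rep_add[OF M1 M2] M3]]) (rule sum)
  moreover have "M1 \<in> carrier_mat (dim_row A + length ds) (dim_row A + length ds)"
    "M2 \<in> carrier_mat (dim_row A + length ds) (dim_row A + length ds)"
    "M3 \<in> carrier_mat (dim_row A + length ds) (dim_row A + length ds)"
    using M1 M2 M3 by (simp_all add: rep_def dA)
  moreover have "quad_mat ta na M1" "quad_mat tb nb M2" "quad_mat tc nc M3"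
    unfolding quad_rep[OF cs(2) ind lin(1) M1] quad_rep[OF cs(2) ind lin(2) M2]
      quad_rep[OF cs(2) ind lin(3) M3] using quad by (simp_all add: quad_def)
  ultimately show thesis by (rule that)
qed

section \<open>From block matrices to endomorphisms\<close>

text \<open>Only the values on \<open>R\<close> are prescribed, because \<open>R\<close> will be
  part of a larger basis on whose other vectors the maps come from matrices. The third map is forced
  on \<open>R\<close>, where \<open>w\<close> will vanish.\<close>

lemma scalar_psum_infinite_basis:
  assumes "infinite R"
    and l: "(\<exists>v1\<in>{x1, y1}. \<exists>v2\<in>{x2, y2}. \<exists>v3\<in>{x3, y3}. l = v1 + v2 + v3)
      \<or> 2 * l = (x1 + y1) + (x2 + y2) + (x3 + y3)"
  obtains f1 f2 where "\<forall>u1 u2 u3 r. lin u1 \<longrightarrow> lin u2 \<longrightarrow> lin u3 \<longrightarrow>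
      (\<forall>r\<in>R. u1 r = f1 r \<and> u2 r = f2 r \<and> u3 r = l *s r - u1 r - u2 r) \<longrightarrow> r \<in> R \<longrightarrow>
      u1 (u1 r) = (x1 + y1) *s u1 r - (x1 * y1) *s r \<and>
      u2 (u2 r) = (x2 + y2) *s u2 r - (x2 * y2) *s r \<and>
      u3 (u3 r) = (x3 + y3) *s u3 r - (x3 * y3) *s r"
  using l
proof
  assume "\<exists>v1\<in>{x1, y1}. \<exists>v2\<in>{x2, y2}. \<exists>v3\<in>{x3, y3}. l = v1 + v2 + v3"
  then obtain v1 v2 v3 where v: "v1 \<in> {x1, y1}" "v2 \<in> {x2, y2}" "v3 \<in> {x3, y3}" "l = v1 + v2 + v3"
    by blast
  have root: "(v * v) *s r = (x + y) *s v *s r - (x * y) *s r" if "v \<in> {x, y}" for v x y r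
    using that by (auto simp: algebra_simps)
  show thesis
  proof (rule that[of "\<lambda>r. v1 *s r" "\<lambda>r. v2 *s r"], intro allI impI)
    fix u1 u2 u3 r
    assume lin: "lin u1" "lin u2" "lin u3"
      and u': "\<forall>r\<in>R. u1 r = v1 *s r \<and> u2 r = v2 *s r \<and> u3 r = l *s r - u1 r - u2 r" and r: "r \<in> R"
    have u: "\<And>r. r \<in> R \<Longrightarrow> u1 r = v1 *s r" "\<And>r. r \<in> R \<Longrightarrow> u2 r = v2 *s r"
      "\<And>r. r \<in> R \<Longrightarrow> u3 r = l *s r - u1 r - u2 r" using u' by simp_all
    have u3: "u3 r = v3 *s r" unfolding u(3)[OF r] u(1)[OF r] u(2)[OF r] v(4)
      by (simp add: algebra_simps)
    have "u1 (u1 r) = (v1 * v1) *s r" "u2 (u2 r) = (v2 * v2) *s r" "u3 (u3 r) = (v3 * v3) *s r"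
      using lin by (simp_all add: u(1,2)[OF r] u3 lin_simps)
    then show "u1 (u1 r) = (x1 + y1) *s u1 r - (x1 * y1) *s r \<and>
      u2 (u2 r) = (x2 + y2) *s u2 r - (x2 * y2) *s r \<and>
      u3 (u3 r) = (x3 + y3) *s u3 r - (x3 * y3) *s r"
      by (simp only: u(1,2)[OF r] u3 root[OF v(1)] root[OF v(2)] root[OF v(3)])
  qed
next
  assume tr: "2 * l = (x1 + y1) + (x2 + y2) + (x3 + y3)"
  \<comment> \<open>An infinite set is equipotent to two copies of itself, so \<open>R\<close>
    splits into pairs \<open>h (Inl s)\<close>, \<open>h (Inr s)\<close>.\<close>
  have "\<exists>h. bij_betw h (R <+> R) R"
    unfolding card_of_ordIso
    using card_of_Plus_infinite[OF assms(1) card_of_mono1[OF subset_refl]] by (rule conjunct1)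
  then obtain h where h: "bij_betw h (R <+> R) R" ..
  define g where "g = the_inv_into (R <+> R) h"
  have gh: "g (h p) = p" if "p \<in> R <+> R" for p
    unfolding g_def using h that by (simp add: bij_betw_def the_inv_into_f_f)
  \<comment> \<open>\<open>\<xi>\<close> is chosen so that \<open>l - f1 - f2\<close> has determinant \<open>x3 y3\<close> on each plane; its trace is right by \<open>tr\<close>.\<close>
  define \<xi> where "\<xi> = (l - x1 - x2) * (l - y1 - y2) - x3 * y3"
  \<comment> \<open>On each plane \<open>f1\<close> is upper triangular with diagonal
    \<open>x1, y1\<close>, and \<open>f2\<close> lower triangular with diagonal
    \<open>x2, y2\<close>, so both have the required characteristic polynomials.\<close>
  define f1 where "f1 r = (case g r of Inl s \<Rightarrow> x1 *s r | Inr s \<Rightarrow> h (Inl s) + y1 *s r)" for r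
  define f2 where "f2 r = (case g r of Inl s \<Rightarrow> x2 *s r + \<xi> *s h (Inr s) | Inr s \<Rightarrow> y2 *s r)" for r
  show thesis
  proof (rule that[of f1 f2], intro allI impI)
    fix u1 u2 u3 r
    assume lin: "lin u1" "lin u2" "lin u3"
      and u': "\<forall>r\<in>R. u1 r = f1 r \<and> u2 r = f2 r \<and> u3 r = l *s r - u1 r - u2 r" and r: "r \<in> R"
    have u: "\<And>r. r \<in> R \<Longrightarrow> u1 r = f1 r" "\<And>r. r \<in> R \<Longrightarrow> u2 r = f2 r"
      "\<And>r. r \<in> R \<Longrightarrow> u3 r = l *s r - u1 r - u2 r" using u' by simp_all
    obtain s where s: "s \<in> R" "r = h (Inl s) \<or> r = h (Inr s)"
      using h r unfolding bij_betw_def by blast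
    define e e' where "e = h (Inl s)" and "e' = h (Inr s)"
    have R: "e \<in> R" "e' \<in> R" using h s(1) unfolding bij_betw_def e_def e'_def by blast+
    have ge: "g e = Inl s" "g e' = Inr s" using gh s(1) unfolding e_def e'_def by auto
    have u12: "u1 e = x1 *s e" "u1 e' = e + y1 *s e'" "u2 e = x2 *s e + \<xi> *s e'" "u2 e' = y2 *s e'"
      using u(1,2) R by (simp_all add: f1_def f2_def ge e_def[symmetric] e'_def[symmetric])
    define \<alpha> \<beta> where "\<alpha> = l - x1 - x2" and "\<beta> = l - y1 - y2"
    have u3: "u3 e = \<alpha> *s e - \<xi> *s e'" "u3 e' = \<beta> *s e' - e"
      unfolding u(3)[OF R(1)] u(3)[OF R(2)] u12 \<alpha>_def \<beta>_def by (simp_all add: algebra_simps)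
    \<comment> \<open>The third map has diagonal entries \<alpha>, \<beta> and off-diagonal entries
      -1, -\<xi>. Its trace and determinant match, so its quadratic equation is Cayley-Hamilton on
      the plane.\<close>
    have tr3: "x3 + y3 = \<alpha> + \<beta>" unfolding \<alpha>_def \<beta>_def using tr by (simp add: algebra_simps)
    have det3: "x3 * y3 = \<alpha> * \<beta> - \<xi>" unfolding \<xi>_def \<alpha>_def \<beta>_def by simp
    note ls = lin_simps[OF lin(1)] lin_simps[OF lin(2)] lin_simps[OF lin(3)]
    from s(2) show "u1 (u1 r) = (x1 + y1) *s u1 r - (x1 * y1) *s r \<and>
      u2 (u2 r) = (x2 + y2) *s u2 r - (x2 * y2) *s r \<and>
      u3 (u3 r) = (x3 + y3) *s u3 r - (x3 * y3) *s r"
      unfolding e_def[symmetric] e'_def[symmetric] tr3 det3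
      by (elim disjE) (simp_all add: u12 u3 ls algebra_simps)
  qed
qed

text \<open>A basis of \<open>V\<close> consists of \<open>bs\<close> and kernel vectors of
  \<open>w\<close>. The given matrices act on \<open>bs\<close> and \<open>q\<close> of these
  vectors; on the infinitely many others the scalar condition on \<open>l\<close> is used.\<close>

lemma psum_of_block_matrix:
  assumes w: "lin w" and A: "in_class scale w A" and inf: "\<not> fin_rank (\<lambda>v. v)"
    and M: "four_block_mat (A + l \<cdot>\<^sub>m 1\<^sub>m (dim_row A)) (0\<^sub>m (dim_row A) q)
      (0\<^sub>m q (dim_row A)) (l \<cdot>\<^sub>m 1\<^sub>m q) = M1 + M2 + M3"
    and carrier: "M1 \<in> carrier_mat (dim_row A + q) (dim_row A + q)" "M2 \<in> carrier_mat (dim_row A + q) (dim_row A + q)"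
    "M3 \<in> carrier_mat (dim_row A + q) (dim_row A + q)"
    and quad: "quad_mat (x1 + y1) (x1 * y1) M1" "quad_mat (x2 + y2) (x2 * y2) M2" "quad_mat (x3 + y3) (x3 * y3) M3"
    and l: "(\<exists>v1\<in>{x1, y1}. \<exists>v2\<in>{x2, y2}. \<exists>v3\<in>{x3, y3}. l = v1 + v2 + v3)
      \<or> 2 * l = (x1 + y1) + (x2 + y2) + (x3 + y3)"
  obtains a b c where "lin a" "lin b" "lin c" "\<forall>v. l *s v + w v = a v + b v + c v"
    "quad (x1 + y1) (x1 * y1) a" "quad (x2 + y2) (x2 * y2) b" "quad (x3 + y3) (x3 * y3) c"
proof -
  obtain bs where bs: "distinct bs" "independent (set bs)" "range w \<subseteq> span (set bs)"
    "\<forall>v. \<exists>x\<in>span (set bs). \<exists>y. w y = 0 \<and> v = x + y" "rep bs w A"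
    by (rule in_class_basis[OF A])
  obtain B where B: "set bs \<subseteq> B" "independent B" "span B = UNIV" "\<forall>x\<in>B - set bs. w x = 0"
    by (rule extend_basis_by_kernel[OF w bs(2,4) subspace_UNIV subset_UNIV])
  have "infinite B" using inf B(3) unfolding fin_rank_def by auto
  then have "infinite (B - set bs)" by simp
  then obtain D where D: "finite D" "card D = q" "D \<subseteq> B - set bs"
    using infinite_arbitrarily_large by blast
  then obtain ds where ds: "set ds = D" "distinct ds" using finite_distinct_list by blast
  have q: "length ds = q" using distinct_card[OF ds(2)] ds(1) D(2) by simp
  let ?cs = "bs @ ds"
  have cs: "set ?cs \<subseteq> B" "distinct ?cs" using ds B(1) D(3) bs(1) by auto
  have ind: "independent (set ?cs)" by (rule independent_mono[OF B(2) cs(1)])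
  define R where "R = B - set ?cs"
  have "infinite R" unfolding R_def using \<open>infinite B\<close> by simp
  obtain f1 f2 where f: "\<forall>u1 u2 u3 r. lin u1 \<longrightarrow> lin u2 \<longrightarrow> lin u3 \<longrightarrow>
      (\<forall>r\<in>R. u1 r = f1 r \<and> u2 r = f2 r \<and> u3 r = l *s r - u1 r - u2 r) \<longrightarrow> r \<in> R \<longrightarrow>
      u1 (u1 r) = (x1 + y1) *s u1 r - (x1 * y1) *s r \<and>
      u2 (u2 r) = (x2 + y2) *s u2 r - (x2 * y2) *s r \<and>
      u3 (u3 r) = (x3 + y3) *s u3 r - (x3 * y3) *s r"
    by (rule scalar_psum_infinite_basis[OF \<open>infinite R\<close> l])
  have dA: "dim_row A = length bs" using bs(5) unfolding rep_def by auto
  have ext: "\<exists>u. lin u \<and> rep ?cs u N \<and> (\<forall>r\<in>R. u r = f r)"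
    if N: "N \<in> carrier_mat (dim_row A + q) (dim_row A + q)" for N f
  proof -
    have inj: "inj_on ((!) ?cs) {..<length ?cs}" using cs(2) by (simp add: inj_on_nth)
    \<comment> \<open>The inverse of list indexing recovers the column number of a vector of
      \<open>?cs\<close>.\<close>
    define g where "g x = (if x \<in> R then f x else
      (\<Sum>i<length ?cs. N $$ (i, the_inv_into {..<length ?cs} ((!) ?cs) x) *s (?cs ! i)))" for x
    obtain u where u: "lin u" "\<forall>x\<in>B. u x = g x"
      using endo.linear_independent_extend[OF B(2), of g] by blast
    have "u (?cs ! j) = (\<Sum>i<length ?cs. N $$ (i, j) *s (?cs ! i))" if "j < length ?cs" for j
    proof -
      have j: "?cs ! j \<in> set ?cs" using that by (rule nth_mem)
      then have "u (?cs ! j) = g (?cs ! j)" using u(2) cs(1) by blast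
      also have "\<dots> = (\<Sum>i<length ?cs. N $$ (i, j) *s (?cs ! i))"
        using that j the_inv_into_f_f[OF inj, of j] unfolding g_def R_def by simp
      finally show ?thesis .
    qed
    then have "rep ?cs u N" using N unfolding rep_def dA q[symmetric] by simp
    moreover have "\<forall>r\<in>R. u r = f r" using u(2) by (simp add: g_def R_def)
    ultimately show ?thesis using u(1) by blast
  qed
  obtain a where a: "lin a" "rep ?cs a M1" "\<And>r. r \<in> R \<Longrightarrow> a r = f1 r"
    using ext[OF carrier(1), of f1] by (elim exE conjE) simp
  obtain b where b: "lin b" "rep ?cs b M2" "\<And>r. r \<in> R \<Longrightarrow> b r = f2 r"
    using ext[OF carrier(2), of f2] by (elim exE conjE) simp
  \<comment> \<open>Defining \<open>c\<close> as the difference makes the sum hold on all of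
    \<open>V\<close>; it remains to see that its matrix on \<open>?cs\<close> is
    \<open>M3\<close>.\<close>
  define c where "c v = (l *s v + w v) - (a v + b v)" for v
  have lin_c: "lin c"
    by (simp add: c_def lin_iff lin_simps[OF a(1)] lin_simps[OF b(1)] lin_simps[OF w] algebra_simps)
  have cR: "c r = l *s r - a r - b r" if "r \<in> R" for r
    using B(4) that unfolding c_def R_def by simp
  have "rep ?cs (\<lambda>v. l *s v + w v) (M1 + M2 + M3)"
    unfolding M[symmetric] q[symmetric]
    by (rule rep_extend_kernel[OF bs(5)]) (use ds(1) B(4) D(3) in blast)
  then have "rep ?cs c (M1 + M2 + M3 - (M1 + M2))"
    unfolding c_def by (rule rep_diff[OF _ rep_add[OF a(2) b(2)]])
  moreover have "M1 + M2 + M3 - (M1 + M2) = M3" using carrier by (intro eq_matI) auto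
  ultimately have c: "rep ?cs c M3" by simp
  have R: "a (a r) = (x1 + y1) *s a r - (x1 * y1) *s r \<and>
      b (b r) = (x2 + y2) *s b r - (x2 * y2) *s r \<and>
      c (c r) = (x3 + y3) *s c r - (x3 * y3) *s r" if "r \<in> R" for r
    using f a(1,3) b(1,3) lin_c cR that by simp
  have BR: "x \<in> set ?cs \<or> x \<in> R" if "x \<in> B" for x using that unfolding R_def by blast
  have "quad (x1 + y1) (x1 * y1) a"
    using quad(1)[unfolded quad_rep[OF cs(2) ind a(1,2)]] R BR
    by (intro quad_on_basis[OF a(1) B(3)]) blast
  moreover have "quad (x2 + y2) (x2 * y2) b"
    using quad(2)[unfolded quad_rep[OF cs(2) ind b(1,2)]] R BR
    by (intro quad_on_basis[OF b(1) B(3)]) blast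
  moreover have "quad (x3 + y3) (x3 * y3) c"
    using quad(3)[unfolded quad_rep[OF cs(2) ind lin_c c]] R BR
    by (intro quad_on_basis[OF lin_c B(3)]) blast
  moreover have "\<forall>v. l *s v + w v = a v + b v + c v" unfolding c_def by simp
  ultimately show thesis using that a(1) b(1) lin_c by simp
qed

end

section \<open>The equivalence\<close>

theorem theorem10:
  fixes scale :: "'a::field \<Rightarrow> 'v::ab_group_add \<Rightarrow> 'v"
    and w :: "'v \<Rightarrow> 'v" and lam :: 'a and p1 p2 p3 :: "'a poly" and A :: "'a mat"
  assumes "vector_space scale"
    and "infinite_dimensional scale"
    and "finite_rank scale w"
    and "split_deg2 p1" and "split_deg2 p2" and "split_deg2 p3"
    and "in_class scale w A"
  shows "endo_psum scale p1 p2 p3 (\<lambda>v. scale lam v + w v) \<longleftrightarrow>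
     ((scalar_psum p1 p2 p3 lam \<or> 2 * lam = poly_trace p1 + poly_trace p2 + poly_trace p3) \<and>
      (\<exists>q::nat. mat_psum p1 p2 p3
         (four_block_mat (A + lam \<cdot>\<^sub>m 1\<^sub>m (dim_row A)) (0\<^sub>m (dim_row A) q)
                         (0\<^sub>m q (dim_row A)) (lam \<cdot>\<^sub>m 1\<^sub>m q))))"
    (is "?endo \<longleftrightarrow> ?scalar \<and> (\<exists>q. mat_psum p1 p2 p3 (?M q))")
proof -
  interpret endomorphisms scale using assms(1) by (simp add: endomorphisms_def)
  obtain m1 x1 y1 where p1: "m1 \<noteq> 0" "p1 = [:m1 * (x1 * y1), - (m1 * (x1 + y1)), m1:]"
    using split_deg2_cases[OF assms(4)] .
  obtain m2 x2 y2 where p2: "m2 \<noteq> 0" "p2 = [:m2 * (x2 * y2), - (m2 * (x2 + y2)), m2:]"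
    using split_deg2_cases[OF assms(5)] .
  obtain m3 x3 y3 where p3: "m3 \<noteq> 0" "p3 = [:m3 * (x3 * y3), - (m3 * (x3 + y3)), m3:]"
    using split_deg2_cases[OF assms(6)] .
  have w: "lin w" "fin_rank w" using assms(3) by (simp_all add: finite_rank_def fin_rank_def)
  have inf: "\<not> fin_rank (\<lambda>v. v)"
    using assms(2) by (auto simp: infinite_dimensional_def fin_rank_def)
  have endo: "?endo \<longleftrightarrow> (\<exists>a b c. lin a \<and> lin b \<and> lin c \<and> (\<forall>v. scale lam v + w v = a v + b v + c v) \<and>
      quad (x1 + y1) (x1 * y1) a \<and> quad (x2 + y2) (x2 * y2) b \<and> quad (x3 + y3) (x3 * y3) c)"
    unfolding endo_psum_def endo_poly_split_eq_0[OF p1] endo_poly_split_eq_0[OF p2]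
      endo_poly_split_eq_0[OF p3] ..
  have scalar: "?scalar \<longleftrightarrow> (\<exists>v1\<in>{x1, y1}. \<exists>v2\<in>{x2, y2}. \<exists>v3\<in>{x3, y3}. lam = v1 + v2 + v3)
      \<or> 2 * lam = (x1 + y1) + (x2 + y2) + (x3 + y3)"
    unfolding scalar_psum_def poly_trace_split[OF p1] poly_trace_split[OF p2] poly_trace_split[OF p3]
      poly_split_eq_0[OF p1] poly_split_eq_0[OF p2] poly_split_eq_0[OF p3] by blast
  have "dim_col A = dim_row A" using assms(7) unfolding in_class_def by auto
  then have dim: "dim_row (?M q) = dim_row A + q" for q by simp
  note mat_eq = mat_poly_split_eq_0[OF p1] mat_poly_split_eq_0[OF p2] mat_poly_split_eq_0[OF p3]
  have mat: "mat_psum p1 p2 p3 (?M q) \<longleftrightarrow> (\<exists>M1 M2 M3. M1 \<in> carrier_mat (dim_row A + q) (dim_row A + q) \<and>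
      M2 \<in> carrier_mat (dim_row A + q) (dim_row A + q) \<and> M3 \<in> carrier_mat (dim_row A + q) (dim_row A + q) \<and>
      ?M q = M1 + M2 + M3 \<and> quad_mat (x1 + y1) (x1 * y1) M1 \<and> quad_mat (x2 + y2) (x2 * y2) M2 \<and>
      quad_mat (x3 + y3) (x3 * y3) M3)" for q
    \<comment> \<open>The rewrite rules in \<open>mat_eq\<close> assume the carrier conditions,
      which \<open>conj_cong\<close> supplies from the earlier conjuncts.\<close>
    unfolding mat_psum_def dim Let_def by (simp only: mat_eq cong: conj_cong)
  show ?thesis
  proof
    assume ?endo
    then obtain a b c where abc: "lin a" "lin b" "lin c" "\<And>v. scale lam v + w v = a v + b v + c v"
      "quad (x1 + y1) (x1 * y1) a" "quad (x2 + y2) (x2 * y2) b" "quad (x3 + y3) (x3 * y3) c"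
      unfolding endo by (elim exE conjE) simp
    interpret quadratic_triple scale a b c w "x1 + y1" "x1 * y1" "x2 + y2" "x2 * y2" "x3 + y3" "x3 * y3" lam
      by (intro quadratic_triple.intro quadratic_triple_axioms.intro endomorphisms_axioms w abc(1-3)
        abc(4)[symmetric] abc(5-7)[unfolded quad_def, rule_format])
    have ?scalar
    \<comment> \<open>The case \<open>d = 0\<close> is the trace condition; otherwise
      \<open>scalar_sum\<close> gives the scalar sum.\<close>
    proof (cases "d = 0")
      case True
      then show ?thesis unfolding scalar d_def by (simp add: algebra_simps)
    next
      case False
      then show ?thesis unfolding scalar using scalar_sum[OF inf False refl refl refl refl refl refl] by simp
    qed
    moreover have "\<exists>q. mat_psum p1 p2 p3 (?M q)"
      unfolding mat
      by (rule block_matrix_of_psum[OF w(1) assms(7) abc(1-3) abc(5-7) abc(4) w(2)]) (intro exI conjI)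
    ultimately show "?scalar \<and> (\<exists>q. mat_psum p1 p2 p3 (?M q))" ..
  next
    assume R: "?scalar \<and> (\<exists>q. mat_psum p1 p2 p3 (?M q))"
    then obtain q M1 M2 M3 where M: "M1 \<in> carrier_mat (dim_row A + q) (dim_row A + q)"
      "M2 \<in> carrier_mat (dim_row A + q) (dim_row A + q)" "M3 \<in> carrier_mat (dim_row A + q) (dim_row A + q)"
      "?M q = M1 + M2 + M3" "quad_mat (x1 + y1) (x1 * y1) M1" "quad_mat (x2 + y2) (x2 * y2) M2"
      "quad_mat (x3 + y3) (x3 * y3) M3"
      unfolding mat by (elim exE conjE)
    obtain a b c where "lin a" "lin b" "lin c" "\<forall>v. scale lam v + w v = a v + b v + c v"
      "quad (x1 + y1) (x1 * y1) a" "quad (x2 + y2) (x2 * y2) b" "quad (x3 + y3) (x3 * y3) c"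
      by (rule psum_of_block_matrix[OF w(1) assms(7) inf M(4,1-3,5-7) R[THEN conjunct1, unfolded scalar]])
    then show ?endo unfolding endo by (intro exI conjI)
  qed
qed

end
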